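(* For every integer $k\ge 3$, every satellite graph $S_{2k+1}$ is a nut graph.
   Context: For an integer $k\ge3$, a satellite graph $S_{2k+1}$ is a simple graph on $2k+1$ vertices whose vertex set is partitioned into a single vertex $v_{\mathrm{dom}}$, a set $V_4=\{u_1,\dots,u_k\}$ and a set $V_2=\{w_1,\dots,w_k\}$, with edges as follows: $v_{\mathrm{dom}}$ is adjacent to every other vertex; each vertex of $V_4$ is adjacent to exactly two vertices of $V_4$ and exactly one vertex of $V_2$; each vertex of $V_2$ is adjacent to exactly one vertex of $V_4$ (and to $v_{\mathrm{dom}}$); there are no other edges. (So vertices of $V_4$ have degree $4$ and vertices of $V_2$ have degree $2$.) A graph $G$ is a nut graph if its adjacency matrix $A_G$ has nullity $1$ and every nonzero vector in $N(A_G)$ has all coordinates nonzero. *)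

theory Defs
  imports "HOL-Analysis.Analysis"
begin

text \<open>A simple graph is given by its adjacency relation on a finite vertex type; all elements of
  the type are vertices.\<close>

definition simple_graph :: "('v::finite \<Rightarrow> 'v \<Rightarrow> bool) \<Rightarrow> bool" where
  "simple_graph E \<longleftrightarrow> symp E \<and> irreflp E"

definition adjacency_matrix :: "('v::finite \<Rightarrow> 'v \<Rightarrow> bool) \<Rightarrow> real ^ 'v ^ 'v" where
  "adjacency_matrix E = (\<chi> i j. if E i j then 1 else 0)"

definition null_space :: "real ^ 'n ^ 'm \<Rightarrow> (real ^ 'n) set" where
  "null_space A = {x. A *v x = 0}"

definition nullity :: "real ^ 'n ^ 'm \<Rightarrow> nat" where
  "nullity A = dim (null_space A)"

definition nut_graph :: "('v::finite \<Rightarrow> 'v \<Rightarrow> bool) \<Rightarrow> bool" where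
  "nut_graph E \<longleftrightarrow>
     simple_graph E \<and>
     nullity (adjacency_matrix E) = 1 \<and>
     (\<forall>x \<in> null_space (adjacency_matrix E). x \<noteq> 0 \<longrightarrow> (\<forall>v. x $ v \<noteq> 0))"

text \<open>The last conjunct, together with the adjacency conditions for \<open>vdom\<close>, \<open>V4\<close> and \<open>V2\<close>,
  expresses that there are no further edges: the only pairs not yet accounted for are those with both
  ends in \<open>V2\<close>.\<close>

definition satellite_graph :: "nat \<Rightarrow> ('v::finite \<Rightarrow> 'v \<Rightarrow> bool) \<Rightarrow> bool" where
  "satellite_graph k E \<longleftrightarrow>
     simple_graph E \<and> CARD('v) = 2 * k + 1 \<and>
     (\<exists>vdom V4 V2.
        {vdom} \<union> V4 \<union> V2 = UNIV \<and> vdom \<notin> V4 \<and> vdom \<notin> V2 \<and> V4 \<inter> V2 = {} \<and>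
        card V4 = k \<and> card V2 = k \<and>
        (\<forall>v. v \<noteq> vdom \<longrightarrow> E vdom v) \<and>
        (\<forall>u\<in>V4. card {x \<in> V4. E u x} = 2 \<and> card {x \<in> V2. E u x} = 1) \<and>
        (\<forall>w\<in>V2. card {x \<in> V4. E w x} = 1) \<and>
        (\<forall>w\<in>V2. \<forall>x\<in>V2. \<not> E w x))"

end

theory Submission
  imports Defs
begin

text \<open>Let \<open>a\<close> be the entry at the dominating vertex of a null vector. The equation at a vertex of
  \<open>V2\<close> forces its neighbour in \<open>V4\<close> to carry \<open>- a\<close>, and the edges between \<open>V4\<close> and \<open>V2\<close> form a
  perfect matching, so all of \<open>V4\<close> carries \<open>- a\<close>; the equation at a vertex of \<open>V4\<close> then reads
  \<open>a - 2 a + b = 0\<close>, where \<open>b\<close> is the entry at its partner in \<open>V2\<close>, so all of \<open>V2\<close> carries \<open>a\<close>.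
  These vectors satisfy the equation at the dominating vertex because \<open>V4\<close> and \<open>V2\<close> are
  equinumerous.\<close>

lemma mem_null_space_adjacency_matrix_iff:
  fixes E :: "'v::finite \<Rightarrow> 'v \<Rightarrow> bool"
  shows "x \<in> null_space (adjacency_matrix E) \<longleftrightarrow> (\<forall>v. (\<Sum>w | E v w. x $ w) = 0)"
proof -
  have "(adjacency_matrix E *v x) $ v = (\<Sum>w | E v w. x $ w)" for v
    unfolding adjacency_matrix_def matrix_vector_mult_def
    by (auto simp: sum.If_cases if_distrib[of "\<lambda>c. c * _"] cong: if_cong)
  then show ?thesis
    by (simp add: null_space_def vec_eq_iff)
qed

text \<open>A single nonzero vector is independent, so its span has dimension 1; every nonzero
  element of that span is a nonzero multiple of \<open>c\<close> and inherits its lack of zero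
  entries.\<close>

lemma nut_graph_if_null_space_eq_span:
  assumes "simple_graph E" and null: "null_space (adjacency_matrix E) = span {c}"
    and nz: "\<And>v. c $ v \<noteq> 0"
  shows "nut_graph E"
proof -
  have "c \<noteq> 0"
    using nz by auto
  then have "nullity (adjacency_matrix E) = 1"
    by (simp add: nullity_def null dim_eq_card_independent)
  moreover have "x $ v \<noteq> 0" if "x \<in> span {c}" "x \<noteq> 0" for x v
    using that nz by (auto simp: span_singleton)
  ultimately show ?thesis
    using assms(1) by (simp add: nut_graph_def null)
qed

text \<open>With \<open>P\<close> as adjacency to a fixed vertex, this splits the null equation
  there into the contributions of the three vertex classes.\<close>

lemma sum_restrict_eq_sum_partition:
  fixes f :: "'v::finite \<Rightarrow> real"
  assumes "{d} \<union> A \<union> B = UNIV" "d \<notin> A" "d \<notin> B" "A \<inter> B = {}"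
  shows "(\<Sum>w | P w. f w) =
    (if P d then f d else 0) + (\<Sum>w | w \<in> A \<and> P w. f w) + (\<Sum>w | w \<in> B \<and> P w. f w)"
proof -
  have "{w. P w} = {w. w = d \<and> P w} \<union> ({w. w \<in> A \<and> P w} \<union> {w. w \<in> B \<and> P w})"
    using assms(1) by blast
  moreover have "{w. w \<in> A \<and> P w} \<inter> {w. w \<in> B \<and> P w} = {}"
    and "{w. w = d \<and> P w} \<inter> ({w. w \<in> A \<and> P w} \<union> {w. w \<in> B \<and> P w}) = {}"
    using assms(2-4) by auto
  moreover have "(\<Sum>w | w = d \<and> P w. f w) = (if P d then f d else 0)"
    by (cases "P d") (auto cong: conj_cong)
  ultimately show ?thesis
    by (simp add: sum.union_disjoint)
qed

theorem theorem4p2: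
  fixes E :: "'v::finite \<Rightarrow> 'v \<Rightarrow> bool" and k :: nat
  assumes "k \<ge> 3"
    and "satellite_graph k E"
  shows "nut_graph E"
proof -
  from assms(2) obtain d A B where simple: "simple_graph E"
    and part: "{d} \<union> A \<union> B = UNIV" "d \<notin> A" "d \<notin> B" "A \<inter> B = {}"
    and card: "card A = k" "card B = k"
    and dom: "\<forall>v. v \<noteq> d \<longrightarrow> E d v"
    and A: "\<forall>u\<in>A. card {x \<in> A. E u x} = 2 \<and> card {x \<in> B. E u x} = 1"
    and BA: "\<forall>w\<in>B. card {x \<in> A. E w x} = 1"
    and BB: "\<forall>w\<in>B. \<forall>x\<in>B. \<not> E w x"
    unfolding satellite_graph_def by (elim conjE exE) (rule that; assumption)
  note dom = dom[rule_format] and BA = BA[rule_format] and BB = BB[rule_format]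
    and AA = A[rule_format, THEN conjunct1] and AB = A[rule_format, THEN conjunct2]
  have E_sym: "E u v \<Longrightarrow> E v u" for u v
    using simple by (auto simp: simple_graph_def dest: sympD)
  have irr: "\<not> E v v" for v
    using simple by (auto simp: simple_graph_def dest: irreflpD)
  have Ed: "E v d" if "v \<in> A \<union> B" for v
    using that part(2,3) by (auto intro!: E_sym[OF dom])
  have cases: "v = d \<or> v \<in> A \<or> v \<in> B" for v
    using part(1) by auto
  have nbrs_B: "{x \<in> B. E w x} = {}" if "w \<in> B" for w
    using that BB by blast
  have nbrs_d: "{x \<in> A. E d x} = A" "{x \<in> B. E d x} = B"
    using part(2,3) by (auto intro!: dom)
  \<comment> \<open>The candidate null vector, normalised to have entry 1 at
    \<open>d\<close>.\<close>
  define c :: "real ^ 'v" where "c = (\<chi> v. if v \<in> A then -1 else 1)"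
  \<comment> \<open>As \<open>c\<close> is constant on each class, its neighbourhood sums reduce to
    the cardinalities fixed by the degree conditions.\<close>
  have c_A: "sum (($) c) {x \<in> A. P x} = - real (card {x \<in> A. P x})" for P
    by (simp add: c_def)
  have c_B: "sum (($) c) {x \<in> B. P x} = real (card {x \<in> B. P x})" for P
    using part(4) by (subst sum.cong[OF refl, of _ _ "\<lambda>_. 1"]) (auto simp: c_def)
  have c_d: "c $ d = 1"
    using part(2) by (simp add: c_def)
  have singleton: "S = {y}" if "card S = 1" "y \<in> S" for S :: "'v set" and y
    using that by (auto simp: card_1_singleton_iff)
  have split: "(\<Sum>w | E v w. x $ w) =
      (if E v d then x $ d else 0) + sum (($) x) {w \<in> A. E v w} + sum (($) x) {w \<in> B. E v w}"
    for x :: "real ^ 'v" and v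
    by (rule sum_restrict_eq_sum_partition[OF part])
  \<comment> \<open>The sums are \<open>- k + k\<close> at \<open>d\<close>,
    \<open>1 - 2 + 1\<close> on \<open>A\<close> and \<open>1 - 1 + 0\<close> on
    \<open>B\<close>.\<close>
  have "(\<Sum>w | E v w. c $ w) = 0" for v
    using cases[of v] unfolding split c_A c_B c_d
    by (auto simp: Ed irr AA AB BA nbrs_B nbrs_d card)
  then have "c \<in> null_space (adjacency_matrix E)"
    by (simp add: mem_null_space_adjacency_matrix_iff)
  moreover have "subspace (null_space (adjacency_matrix E))"
    unfolding null_space_def
    by (rule linear_subspace_kernel) (rule matrix_vector_mul_linear)
  ultimately have "span {c} \<subseteq> null_space (adjacency_matrix E)"
    by (simp add: span_minimal)
  moreover have "x \<in> span {c}" if "x \<in> null_space (adjacency_matrix E)" for x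
  proof -
    have eq: "(\<Sum>w | E v w. x $ w) = 0" for v
      using that by (simp add: mem_null_space_adjacency_matrix_iff)
    have x_A: "x $ u = - x $ d" if u: "u \<in> A" for u
    proof -
      obtain w where w: "w \<in> B" "E u w"
        using AB[OF u] by (force simp: card_1_singleton_iff)
      \<comment> \<open>By symmetry \<open>u\<close> is the one neighbour of \<open>w\<close> in
        \<open>A\<close>, so the equation at \<open>w\<close> involves only \<open>d\<close> and
        \<open>u\<close>.\<close>
      then have "{y \<in> A. E w y} = {u}"
        using u E_sym by (intro singleton BA) auto
      then show ?thesis
        using eq[of w] w(1) by (simp add: split Ed nbrs_B)
    qed
    have x_B: "x $ w = x $ d" if w: "w \<in> B" for w
    proof -
      obtain u where u: "u \<in> A" "E w u"
        using BA[OF w] by (force simp: card_1_singleton_iff)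
      then have "{y \<in> B. E u y} = {w}"
        using w E_sym by (intro singleton AB) auto
      \<comment> \<open>By \<open>x_A\<close> the two neighbours of \<open>u\<close> in
        \<open>A\<close> contribute \<open>- 2 * x $ d\<close> in total, whichever they are.\<close>
      then show ?thesis
        using eq[of u] u(1) by (simp add: split Ed x_A AA)
    qed
    \<comment> \<open>The factor is forced by the entry at \<open>d\<close>, where \<open>c\<close>
      is 1.\<close>
    have "x = (x $ d) *\<^sub>R c"
      unfolding vec_eq_iff
    proof
      fix v
      show "x $ v = ((x $ d) *\<^sub>R c) $ v"
        using cases[of v] part(2,4) by (auto simp: c_def x_A x_B)
    qed
    then show ?thesis
      by (metis span_base span_scale singletonI)
  qed
  ultimately have "null_space (adjacency_matrix E) = span {c}"
    by blast
  then show ?thesis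
    by (rule nut_graph_if_null_space_eq_span[OF simple]) (simp add: c_def)
qed

end
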